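(* Let $n\le m$ and let $p$ be a degree-$n$ homogeneous real stable polynomial in variables $y_1,\dots,y_m$ with non-negative coefficients. For any set $S\subseteq[m]$ let $c_S$ denote the coefficient of the monomial $y^S:=\prod_{i\in S}y_i$ in $p$. If $\sum_{S\in\binom{[m]}{n}}c_S>0$, then $$\sum_{S\in\binom{[m]}{n}}c_S\;\ge\;\frac{m!\,(m-n)^{m-n}}{m^m\,(m-n)!}\inf_{\substack{{\bf y}>0:\\ y^S\ge 1\ \forall S\in\binom{[m]}{n}}}p({\bf y})\;\ge\;e^{-n}\inf_{\substack{{\bf y}>0:\\ y^S\ge 1\ \forall S\in\binom{[m]}{n}}}p({\bf y}).$$
   Context: A polynomial $p(z_1,\dots,z_m)$ with complex coefficients is stable if $p(z_1,\dots,z_m)\neq 0$ whenever $\mathrm{Im}(z_i)>0$ for all $i$; it is real stable if it is stable and all its coefficients are real. It is degree-$n$ homogeneous if every monomial has degree exactly $n$. $[m]=\{1,\dots,m\}$, $\binom{[m]}{n}$ is the family of $n$-element subsets of $[m]$, and ${\bf y}>0$ means all coordinates are positive. The convention $0^0=1$ is used when $m=n$. *)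

theory Defs
  imports Complex_Main "HOL-Library.Poly_Mapping"
begin

text \<open>
  Multivariate polynomials are finitely supported maps from monomials to coefficients, a monomial
  being the finitely supported map from variable indices to exponents; addition and multiplication
  are those of \<^theory>\<open>HOL-Library.Poly_Mapping\<close>. The variables are indexed by \<^typ>\<open>nat\<close>;
  membership in \<open>mpolys m\<close> restricts them to the indices \<open>1, \<dots>, m\<close>.
\<close>

type_synonym 'a mpoly = "(nat \<Rightarrow>\<^sub>0 nat) \<Rightarrow>\<^sub>0 'a"

definition mpolys :: "nat \<Rightarrow> 'a::zero mpoly set" where
  "mpolys m = {p. \<forall>t \<in> Poly_Mapping.keys p. Poly_Mapping.keys t \<subseteq> {1..m}}"

definition mpoly_eval :: "'a::comm_semiring_1 mpoly \<Rightarrow> (nat \<Rightarrow> 'a) \<Rightarrow> 'a" where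
  "mpoly_eval p x =
     (\<Sum>t \<in> Poly_Mapping.keys p. Poly_Mapping.lookup p t *
        (\<Prod>i \<in> Poly_Mapping.keys t. x i ^ Poly_Mapping.lookup t i))"

definition monom_degree :: "(nat \<Rightarrow>\<^sub>0 nat) \<Rightarrow> nat" where
  "monom_degree t = (\<Sum>i \<in> Poly_Mapping.keys t. Poly_Mapping.lookup t i)"

definition mpoly_homogeneous :: "nat \<Rightarrow> 'a::zero mpoly \<Rightarrow> bool" where
  "mpoly_homogeneous n p \<longleftrightarrow> (\<forall>t \<in> Poly_Mapping.keys p. monom_degree t = n)"

definition mpoly_stable :: "nat \<Rightarrow> complex mpoly \<Rightarrow> bool" where
  "mpoly_stable m p \<longleftrightarrow> (\<forall>z. (\<forall>i \<in> {1..m}. Im (z i) > 0) \<longrightarrow> mpoly_eval p z \<noteq> 0)"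

text \<open>Reality of the coefficients is expressed by the type.\<close>

definition mpoly_real_stable :: "nat \<Rightarrow> real mpoly \<Rightarrow> bool" where
  "mpoly_real_stable m p \<longleftrightarrow> mpoly_stable m (Poly_Mapping.map complex_of_real p)"

definition set_coeff :: "'a::zero mpoly \<Rightarrow> nat set \<Rightarrow> 'a" where
  "set_coeff p S = Poly_Mapping.lookup p (\<Sum>i\<in>S. Poly_Mapping.single i 1)"

definition n_subsets :: "nat \<Rightarrow> nat \<Rightarrow> nat set set" where
  "n_subsets m n = {S. S \<subseteq> {1..m} \<and> card S = n}"

text \<open>Only the coordinates \<open>y 1, \<dots>, y m\<close> matter; the remaining values of \<open>y\<close> are arbitrary.\<close>

definition feasible_points :: "nat \<Rightarrow> nat \<Rightarrow> (nat \<Rightarrow> real) set" where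
  "feasible_points m n =
     {y. (\<forall>i \<in> {1..m}. y i > 0) \<and> (\<forall>S \<in> n_subsets m n. (\<Prod>i\<in>S. y i) \<ge> 1)}"

end

theory Submission
  imports Defs
    "HOL-Complex_Analysis.Complex_Analysis"
    "HOL-Computational_Algebra.Fundamental_Theorem_Algebra"
    "HOL-Combinatorics.Multiset_Permutations"
begin

text \<open>
  The polynomial \<open>P(y) = p(y) (y\<^sub>1 + \<dots> + y\<^sub>m)\<^bsup>m-n\<^esup>\<close> is stable and homogeneous of degree \<open>m\<close>, and its
  coefficient at \<open>y\<^sub>1 \<cdots> y\<^sub>m\<close> is \<open>(m-n)!\<close> times the sum of the \<open>c\<^sub>S\<close>. Gurvits' capacity inequality
  bounds this coefficient below by \<open>m!/m\<^sup>m\<close> times the infimum of \<open>P(y) / (y\<^sub>1 \<cdots> y\<^sub>m)\<close> over positive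
  \<open>y\<close>, and scaling together with AM-GM compares that infimum with the one of \<open>p\<close> over the feasible
  points. The capacity inequality removes one variable at a time: the coefficient of \<open>y\<^sub>j\<close> in a
  stable polynomial is again stable (Gauss--Lucas and Hurwitz), and for a real-rooted polynomial
  \<open>R\<close> of degree at most \<open>j\<close> with \<open>R(t) \<ge> C t\<close> for all \<open>t > 0\<close>, AM-GM on the linear factors gives
  \<open>R'(0) \<ge> ((j-1)/j)\<^bsup>j-1\<^esup> C\<close>.
\<close>

section \<open>Univariate polynomials\<close>

text \<open>Bernoulli's inequality for the ratio of the mean \<open>A\<close> to \<open>y\<close>.
  This is AM-GM for \<open>Suc n\<close> numbers of which \<open>n\<close> agree, the only case that
  the inductions below call for.\<close>

lemma weighted_am_gm:
  fixes x y :: real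
  assumes "x \<ge> 0" "y > 0"
  shows "x * y ^ n \<le> ((x + real n * y) / real (Suc n)) ^ Suc n"
proof -
  define A where "A = (x + real n * y) / real (Suc n)"
  have A: "A * real (Suc n) = x + real n * y" "A \<ge> 0"
    using assms by (auto simp: A_def)
  have "1 + real (Suc n) * (A / y - 1) \<le> (1 + (A / y - 1)) ^ Suc n"
    using A assms by (intro Bernoulli_inequality) auto
  moreover have "1 + real (Suc n) * (A / y - 1) = x / y"
    using A(1) assms by (simp add: field_simps)
  ultimately have "x / y * y ^ Suc n \<le> (A / y) ^ Suc n * y ^ Suc n"
    using assms by (intro mult_right_mono) auto
  moreover have "x / y * y ^ Suc n = x * y ^ n" "(A / y) ^ Suc n * y ^ Suc n = A ^ Suc n"
    using assms by (simp_all add: power_divide)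
  ultimately show ?thesis
    by (simp only: A_def)
qed

text \<open>Adding an element replaces the earlier ones by their mean \<open>s / n\<close>, which
  reduces the step to \<open>weighted_am_gm\<close>. Stated without division, AM-GM also covers the
  empty set, with 0^0 = 1.\<close>

lemma prod_le_power_mean:
  fixes x :: "'a \<Rightarrow> real"
  assumes "finite A" "\<And>i. i \<in> A \<Longrightarrow> x i > 0"
  shows "real (card A) ^ card A * prod x A \<le> sum x A ^ card A"
  using assms
proof (induction A rule: finite_induct)
  case (insert b A)
  show ?case
  proof (cases "A = {}")
    case False
    define n where "n = card A"
    have n: "n > 0" using False insert by (auto simp: n_def)
    define s where "s = sum x A"
    have s: "s > 0" unfolding s_def using insert False by (intro sum_pos) auto
    have "x b * (s / n) ^ n \<le> ((x b + real n * (s / n)) / real (Suc n)) ^ Suc n"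
      using insert.prems s n by (intro weighted_am_gm) (auto simp: less_imp_le)
    also have "\<dots> = (x b + s) ^ Suc n / real (Suc n) ^ Suc n"
      using n by (simp add: power_divide)
    finally have 1: "x b * (s / n) ^ n * real (Suc n) ^ Suc n \<le> (x b + s) ^ Suc n"
      by (simp add: pos_le_divide_eq)
    have "real n ^ n * prod x A \<le> s ^ n"
      using insert by (simp add: n_def s_def)
    then have "prod x A \<le> (s / n) ^ n"
      using n by (simp add: power_divide field_simps)
    then have "x b * prod x A * real (Suc n) ^ Suc n \<le> x b * (s / n) ^ n * real (Suc n) ^ Suc n"
      using insert.prems by (intro mult_right_mono mult_left_mono) (auto simp: less_imp_le)
    with 1 show ?thesis
      using insert.hyps by (simp add: n_def s_def mult_ac)
  qed simp
qed simp

section \<open>Gauss--Lucas for the upper half plane\<close>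

text \<open>The logarithmic derivative is the sum of \<open>1 / (t - r)\<close> over the roots.
  Every root has \<open>Im r \<le> 0\<close>, so \<open>t - r\<close> lies in the upper half plane
  and its inverse in the lower one. The induction splits off one root at a time.\<close>

lemma Im_logderiv_nonpos:
  fixes p :: "complex poly"
  assumes "p \<noteq> 0" "\<And>w. Im w > 0 \<Longrightarrow> poly p w \<noteq> 0" "Im t > 0"
  shows "Im (poly (pderiv p) t / poly p t) \<le> 0 \<and>
    (degree p > 0 \<longrightarrow> Im (poly (pderiv p) t / poly p t) < 0)"
  using assms(1,2)
proof (induction "degree p" arbitrary: p)
  case 0
  then obtain c where "p = [:c:]" by (metis degree_eq_zeroE)
  then show ?case by simp
next
  case (Suc d)
  then obtain r where r: "poly p r = 0"
    using alg_closed_imp_poly_has_root[of p] by auto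
  then obtain q where q: "p = [:-r, 1:] * q"
    by (metis poly_eq_0_iff_dvd dvdE)
  have "q \<noteq> 0" using Suc q by auto
  have dq: "d = degree q" using Suc.hyps(2) \<open>q \<noteq> 0\<close> unfolding q by (subst (asm) degree_mult_eq) auto
  have "Im (poly (pderiv q) t / poly q t) \<le> 0"
    using Suc.hyps(1)[OF dq] \<open>q \<noteq> 0\<close> Suc.prems q by auto
  moreover have pt: "poly p t \<noteq> 0" using Suc assms by blast
  moreover have "Im (t - r) > 0"
    using Suc.prems(2)[of r] r assms(3) by (cases "Im r > 0") auto
  then have "Im (1 / (t - r)) < 0"
    by (simp add: Im_divide add_pos_nonneg divide_neg_pos sum_power2_gt_zero_iff)
  moreover have "poly (pderiv p) t / poly p t = 1 / (t - r) + poly (pderiv q) t / poly q t"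
    using pt unfolding q pderiv_mult by (simp add: pderiv_pCons field_simps)
  ultimately show ?case by simp
qed

text \<open>A zero of the derivative would make the logarithmic derivative vanish, although its
  imaginary part is strictly negative.\<close>

lemma pderiv_nonzero_upper_halfplane:
  fixes p :: "complex poly"
  assumes "degree p > 0" "\<And>w. Im w > 0 \<Longrightarrow> poly p w \<noteq> 0" "Im t > 0"
  shows "poly (pderiv p) t \<noteq> 0"
  using Im_logderiv_nonpos[of p t] assms by fastforce

section \<open>Real-rooted polynomials\<close>

lemma poly_of_real_poly:
  "poly (map_poly complex_of_real p) (complex_of_real x) = complex_of_real (poly p x)"
  by (induction p) (auto simp: map_poly_pCons)

lemma map_poly_complex_of_real_mult:
  "map_poly complex_of_real (p * q) = map_poly complex_of_real p * map_poly complex_of_real q"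
  by (intro poly_eqI) (simp add: coeff_map_poly coeff_mult)

text \<open>Here p(t)/p(0) is the product of the factors 1 + t/(-r) over the roots r < 0, and
  p'(0)/p(0) is the sum of the 1/(-r). AM-GM bounds the product by a power of the mean factor; if
  the degree is below \<open>d\<close>, the missing factors count as 1.\<close>

lemma real_rooted_poly_le_power:
  fixes p :: "real poly"
  assumes "poly p 0 > 0"
    and "\<And>w. poly (map_poly complex_of_real p) w = 0 \<Longrightarrow> w \<in> \<real> \<and> Re w < 0"
    and "degree p \<le> d" and "d > 0" and "t \<ge> 0"
  shows "coeff p 1 \<ge> 0 \<and> poly p t \<le> poly p 0 * (1 + coeff p 1 / poly p 0 * t / d) ^ d"
  using assms(1-4)
proof (induction d arbitrary: p)
  case (Suc d)
  show ?case
  proof (cases "degree p = 0")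
    case True
    then obtain c where "p = [:c:]" by (metis degree_eq_zeroE)
    then show ?thesis by simp
  next
    case False
    then have "degree (map_poly complex_of_real p) > 0"
      by (simp add: degree_map_poly)
    then obtain z where z: "poly (map_poly complex_of_real p) z = 0"
      using alg_closed_imp_poly_has_root by blast
    then obtain r where r: "z = complex_of_real r" "r < 0"
      using Suc.prems(2) by (metis Reals_cases Re_complex_of_real)
    then have "poly p r = 0" using z by (simp add: poly_of_real_poly)
    then obtain q where q: "p = [:-r, 1:] * q"
      by (metis poly_eq_0_iff_dvd dvdE)
    have q0: "q \<noteq> 0" using False q by auto
    have dq: "degree q \<le> d" using Suc.prems(3) q0 unfolding q by (subst (asm) degree_mult_eq) auto
    have pq: "poly p 0 = (-r) * poly q 0" "coeff p 1 = poly q 0 - r * coeff q 1"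
      by (simp_all add: q poly_0_coeff_0)
    have q0p: "poly q 0 > 0" using Suc.prems(1) r pq by (simp add: mult_less_0_iff)
    have ps: "coeff p 1 / poly p 0 = 1/(-r) + coeff q 1 / poly q 0"
      using pq r q0p by (simp add: field_simps)
    have pt: "poly p t = poly p 0 * ((1 + t/(-r)) * (poly q t / poly q 0))"
      using q0p r by (simp add: q field_simps)
    have roots: "\<And>w. poly (map_poly complex_of_real q) w = 0 \<Longrightarrow> w \<in> \<real> \<and> Re w < 0"
      using Suc.prems(2) by (simp add: q map_poly_complex_of_real_mult del: mult_pCons_left)
    \<comment> \<open>The induction hypothesis divides by \<open>d\<close>, so linear
      \<open>p\<close> is treated apart.\<close>
    show ?thesis
    proof (cases "d = 0")
      case True
      then obtain c where "q = [:c:]" using dq by (metis degree_eq_zeroE le_zero_eq)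
      then show ?thesis using True q r q0p assms(5) by (simp add: field_simps)
    next
      case False
      define s where "s = coeff q 1 / poly q 0"
      have IH: "coeff q 1 \<ge> 0" "poly q t \<le> poly q 0 * (1 + s * t / d) ^ d"
        using Suc.IH[OF q0p roots dq] False unfolding s_def by auto
      have s: "s \<ge> 0" using IH q0p by (simp add: s_def)
      have "poly q t / poly q 0 \<le> (1 + s * t / d) ^ d"
        using IH(2) q0p by (simp add: field_simps)
      then have "(1 + t/(-r)) * (poly q t / poly q 0) \<le> (1 + t/(-r)) * (1 + s * t / d) ^ d"
        using assms(5) r by (intro mult_left_mono) (auto intro!: add_nonneg_nonneg simp: divide_nonneg_neg field_simps)
      also have "\<dots> \<le> ((1 + t/(-r) + real d * (1 + s * t / d)) / real (Suc d)) ^ Suc d"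
        using assms(5) r s by (intro weighted_am_gm) (auto simp: divide_nonneg_neg field_simps intro!: add_pos_nonneg)
      also have "(1 + t/(-r) + real d * (1 + s * t / d)) / real (Suc d) = 1 + (1/(-r) + s) * t / Suc d"
      proof -
        have "1 + t/(-r) + real d * (1 + s * t / d) = real (Suc d) + (1/(-r) + s) * t"
          using False by (simp add: algebra_simps)
        then show ?thesis by (simp only: add_divide_distrib) (simp del: of_nat_Suc)
      qed
      finally have "poly p t \<le> poly p 0 * (1 + coeff p 1 / poly p 0 * t / Suc d) ^ Suc d"
        unfolding pt ps s_def using Suc.prems(1) by (intro mult_left_mono) auto
      moreover have "r * coeff q 1 \<le> 0" using r IH(1) by (simp add: mult_nonpos_nonneg)
      then have "coeff p 1 \<ge> 0" using pq q0p by linarith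
      ultimately show ?thesis by blast
    qed
  qed
qed simp

text \<open>With a = p(0) > 0 and s = p'(0), the bound C t \<le> a (1 + s t / (a (d+1)))^(d+1) is
  evaluated at the best \<open>t\<close>. A root at 0 is handled by a limit, which is why
  \<open>roots\<close> is conditional.\<close>

lemma coeff_1_ge_capacity:
  fixes p :: "real poly"
  assumes roots: "poly p 0 \<noteq> 0 \<Longrightarrow> (\<And>w. poly (map_poly complex_of_real p) w = 0 \<Longrightarrow> w \<in> \<real> \<and> Re w < 0)"
    and "poly p 0 \<ge> 0" and deg: "degree p \<le> Suc d" and "C \<ge> 0"
    and ge: "\<And>t. t > 0 \<Longrightarrow> poly p t \<ge> C * t"
  shows "coeff p 1 \<ge> (real d / real (Suc d)) ^ d * C"
proof (cases "poly p 0 = 0")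
  case True
  \<comment> \<open>Cancelling \<open>t\<close> leaves \<open>C \<le> poly q t\<close> for
    \<open>t > 0\<close>, and letting \<open>t\<close> tend to 0 bounds \<open>poly q 0\<close>,
    which is \<open>coeff p 1\<close>.\<close>
  then obtain q where q: "p = [:0, 1:] * q"
    by (metis poly_eq_0_iff_dvd dvdE minus_zero)
  have "C \<le> poly q t" if "t > 0" for t
    using ge[OF that] that by (simp add: q mult.commute)
  moreover have "((\<lambda>t. poly q t) \<longlongrightarrow> poly q 0) (at_right 0)"
    by (intro tendsto_intros)
  ultimately have "C \<le> poly q 0"
    by (intro tendsto_lowerbound[of "poly q" "poly q 0" "at_right 0" C])
       (auto simp: eventually_at_filter)
  moreover have "(real d / real (Suc d)) ^ d * C \<le> 1 * C"
    using assms by (intro mult_right_mono power_le_one) auto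
  ultimately show ?thesis by (simp add: q poly_0_coeff_0)
next
  case False
  define a where "a = poly p 0"
  define s where "s = coeff p 1"
  have a: "a > 0" using False assms a_def by auto
  have bound: "s \<ge> 0" "t > 0 \<Longrightarrow> C * t \<le> a * (1 + s / a * t / Suc d) ^ Suc d" for t
    using real_rooted_poly_le_power[of p "Suc d" t] roots False a deg ge[of t]
      real_rooted_poly_le_power[of p "Suc d" 0]
    unfolding a_def s_def by auto
  show ?thesis
  proof (cases "s = 0 \<or> C = 0")
    case True
    have "C = 0"
    proof (rule ccontr)
      assume "C \<noteq> 0"
      then have "C > 0" "s = 0" using True assms by auto
      \<comment> \<open>For \<open>s = 0\<close> the bound reads \<open>C * t \<le> a\<close>, and
        this \<open>t\<close> gives \<open>2 * a \<le> a\<close>.\<close>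
      then show False using bound(2)[of "2 * a / C"] a by simp
    qed
    then show ?thesis using bound(1) s_def by simp
  next
    case F: False
    then have s: "s > 0" and C: "C > 0" using bound assms by auto
    show ?thesis
    proof (cases "d = 0")
      case True
      \<comment> \<open>Now the bound is \<open>C * t \<le> a + s * t\<close>, whose optimum lies at
        infinity; a finite \<open>t\<close> with \<open>(C - s) * t = 2 * a\<close> already
        contradicts it.\<close>
      have "C \<le> s"
      proof (rule ccontr)
        assume "\<not> C \<le> s"
        then have "C * (2 * a / (C - s)) \<le> a * (1 + s / a * (2 * a / (C - s)))"
          using bound(2)[of "2 * a / (C - s)"] a True by simp
        also have "\<dots> = a + s * (2 * a / (C - s))"
          using a by (simp add: algebra_simps)
        finally have "(C - s) * (2 * a / (C - s)) \<le> a"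
          unfolding left_diff_distrib by linarith
        then show False using a \<open>\<not> C \<le> s\<close> by simp
      qed
      then show ?thesis using True s_def by simp
    next
      case False
      define D where "D = real d"
      have D: "D > 0" using False D_def by simp
      \<comment> \<open>This \<open>t\<close> minimises (1 + s t / (a (d+1)))^(d+1) / t.\<close>
      define t where "t = (D + 1) / D * (a / s)"
      have t: "t > 0" using D a s by (simp add: t_def)
      have "C * t \<le> a * (1 + s / a * t / Suc d) ^ Suc d" using bound(2) t by blast
      also have "1 + s / a * t / Suc d = (D + 1) / D"
      proof -
        have "s / a * t / Suc d = 1 / D"
          using a s D by (simp add: t_def D_def add.commute)
        then show ?thesis using D by (simp only: add_divide_distrib) simp
      qed
      finally have "C * (a / s) * ((D + 1) / D) \<le> a * ((D + 1) / D) ^ d * ((D + 1) / D)"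
        by (simp add: t_def mult_ac)
      then have "C * (a / s) \<le> a * ((D + 1) / D) ^ d"
        using D by (subst (asm) mult_le_cancel_right) auto
      then have "a * C \<le> a * (s * ((D + 1) / D) ^ d)"
        using s by (simp add: pos_divide_le_eq mult_ac)
      then have "C \<le> s * ((D + 1) / D) ^ d"
        using a by (simp only: mult_le_cancel_left_pos)
      then have "(D / (D + 1)) ^ d * C \<le> s"
        using D by (simp add: power_divide field_simps)
      then show ?thesis by (simp add: D_def s_def add.commute)
    qed
  qed
qed

section \<open>Stable polynomials and capacity\<close>

definition upper_points :: "nat \<Rightarrow> (nat \<Rightarrow> complex) set" where
  "upper_points j = {z. \<forall>i\<in>{1..j}. Im (z i) > 0}"

text \<open>The exponent vectors \<open>e a\<close> need not be distinct for distinct \<open>a\<close>; this allows the product of two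
  polynomials to be indexed by pairs without collecting terms.\<close>

definition sparse_eval ::
  "nat \<Rightarrow> 'a set \<Rightarrow> ('a \<Rightarrow> 'b) \<Rightarrow> ('a \<Rightarrow> nat \<Rightarrow> nat) \<Rightarrow> (nat \<Rightarrow> 'b::comm_semiring_1) \<Rightarrow> 'b" where
  "sparse_eval j I c e x = (\<Sum>a\<in>I. c a * (\<Prod>i=1..j. x i ^ e a i))"

definition slice ::
  "nat \<Rightarrow> 'a set \<Rightarrow> ('a \<Rightarrow> 'b) \<Rightarrow> ('a \<Rightarrow> nat \<Rightarrow> nat) \<Rightarrow> (nat \<Rightarrow> 'b::comm_semiring_1) \<Rightarrow> 'b poly" where
  "slice j I c e x = (\<Sum>a\<in>I. monom (c a * (\<Prod>i=1..j. x i ^ e a i)) (e a (Suc j)))"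

lemma pderiv_sum: "pderiv (sum f A) = (\<Sum>a\<in>A. pderiv (f a))"
  by (induction A rule: infinite_finite_induct) (auto simp: pderiv_add)

lemma poly_slice:
  "poly (slice j I c e x) t = sparse_eval (Suc j) I c e (x(Suc j := t))"
proof -
  have "(\<Prod>i=1..j. (x(Suc j := t)) i ^ f i) = (\<Prod>i=1..j. x i ^ f i)" for f :: "nat \<Rightarrow> nat"
    by (intro prod.cong) auto
  then show ?thesis
    by (simp add: slice_def sparse_eval_def poly_sum poly_monom mult_ac)
qed

lemma coeff_slice:
  assumes "finite I"
  shows "coeff (slice j I c e x) k = sparse_eval j {a\<in>I. e a (Suc j) = k} c e x"
  using assms by (simp add: slice_def sparse_eval_def coeff_sum sum.If_cases Int_def)

lemma sparse_eval_of_real: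
  "sparse_eval j I (\<lambda>a. complex_of_real (c a)) e (\<lambda>i. complex_of_real (x i)) = complex_of_real (sparse_eval j I c e x)"
  by (simp add: sparse_eval_def)

lemma sparse_eval_nonneg:
  fixes c :: "'a \<Rightarrow> real"
  assumes "\<And>a. a \<in> I \<Longrightarrow> c a > 0" "\<And>i. i \<in> {1..j} \<Longrightarrow> y i > 0"
  shows "sparse_eval j I c e y \<ge> 0"
  unfolding sparse_eval_def
  by (intro sum_nonneg mult_nonneg_nonneg prod_nonneg zero_le_power) (use assms less_imp_le in blast)+

lemma map_poly_slice:
  assumes "finite I"
  shows "map_poly complex_of_real (slice j I c e x) =
    slice j I (\<lambda>a. complex_of_real (c a)) e (\<lambda>i. complex_of_real (x i))"
  using assms by (intro poly_eqI) (simp add: coeff_map_poly coeff_slice sparse_eval_of_real)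

lemma sparse_eval_scale:
  assumes "\<And>a. a \<in> I \<Longrightarrow> (\<Sum>i=1..j. e a i) = h"
  shows "sparse_eval j I c e (\<lambda>i. u * x i) = u ^ h * sparse_eval j I c e x"
proof -
  have "c a * (\<Prod>i=1..j. (u * x i) ^ e a i) = u ^ h * (c a * (\<Prod>i=1..j. x i ^ e a i))" if "a \<in> I" for a
    using assms[OF that] by (simp add: power_mult_distrib prod.distrib power_sum[symmetric] mult_ac)
  then show ?thesis unfolding sparse_eval_def by (simp add: sum_distrib_left)
qed

section \<open>Limits and coefficients of stable polynomials\<close>

text \<open>Provides the uniform convergence on compact sets for Hurwitz's theorem when only the
  coefficients vary.\<close>

lemma uniform_limit_sum_scaled:
  fixes \<kappa> :: "nat \<Rightarrow> 'a \<Rightarrow> complex"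
  assumes "finite I" "\<And>a. a \<in> I \<Longrightarrow> (\<lambda>n. \<kappa> n a) \<longlonglongrightarrow> k a"
    and "\<And>a. a \<in> I \<Longrightarrow> bounded (g a ` K)"
  shows "uniform_limit K (\<lambda>n w. \<Sum>a\<in>I. \<kappa> n a * g a w) (\<lambda>w. \<Sum>a\<in>I. k a * g a w) sequentially"
  using assms
proof (induction I rule: finite_induct)
  case empty
  then show ?case by (simp add: uniform_limit_const)
next
  case (insert b I)
  have "uniform_limit K (\<lambda>n w. \<kappa> n b) (\<lambda>w. k b) sequentially"
    using insert.prems(1)[of b] by (auto simp: uniform_limit_iff tendsto_iff)
  then have "uniform_limit K (\<lambda>n w. \<kappa> n b * g b w) (\<lambda>w. k b * g b w) sequentially"
    by (rule uniform_lim_mult[OF _ uniform_limit_const])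
       (use insert.prems in \<open>auto simp: image_constant_conv\<close>)
  then show ?case
    using insert by (auto intro!: uniform_limit_add)
qed

text \<open>Hurwitz's theorem is applied on the complex line through \<open>z\<close> and \<open>(\<i>, \<dots>, \<i>)\<close>.\<close>

lemma sparse_eval_limit_nonzero:
  fixes \<kappa> :: "nat \<Rightarrow> 'a \<Rightarrow> complex"
  assumes "finite I"
    and nz: "\<And>n z. z \<in> upper_points j \<Longrightarrow> sparse_eval j I (\<kappa> n) e z \<noteq> 0"
    and lim: "\<And>a. a \<in> I \<Longrightarrow> (\<lambda>n. \<kappa> n a) \<longlonglongrightarrow> k a"
    and ne: "sparse_eval j I k e (\<lambda>_. \<i>) \<noteq> 0"
    and z: "z \<in> upper_points j"
  shows "sparse_eval j I k e z \<noteq> 0"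
proof
  assume z0: "sparse_eval j I k e z = 0"
  define l where "l = (\<lambda>w i. (1 - w) * z i + w * \<i>)"
  define S where "S = {w. l w \<in> upper_points j}"
  define g where "g = (\<lambda>a w. \<Prod>i=1..j. l w i ^ e a i)"
  have S_eq: "S = (\<Inter>i\<in>{1..j}. {w. 0 < Im (l w i)})"
    by (auto simp: S_def upper_points_def)
  have "open S"
    unfolding S_eq l_def by (intro open_INT ballI open_Collect_less continuous_intros finite_atLeastAtMost)
  \<comment> \<open>Each coordinate of \<open>l\<close> is affine in \<open>w\<close>, so
    \<open>S\<close> is an intersection of convex sets and therefore connected.\<close>
  have "convex {w. 0 < Im (l w i)}" for i
  proof (rule convexI, clarify)
    fix x y :: complex and u v :: real
    assume *: "0 < Im (l x i)" "0 < Im (l y i)" "0 \<le> u" "0 \<le> v" "u + v = 1"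
    have "l (u *\<^sub>R x + v *\<^sub>R y) i = u *\<^sub>R l x i + v *\<^sub>R l y i + (1 - (u + v)) *\<^sub>R z i"
      by (simp add: l_def algebra_simps scaleR_conv_of_real)
    then have "Im (l (u *\<^sub>R x + v *\<^sub>R y) i) = u * Im (l x i) + v * Im (l y i)"
      using * by simp
    also have "\<dots> > 0"
      using * by (metis add.commute add_0 add_nonneg_pos add_pos_nonneg mult_nonneg_nonneg
          mult_pos_pos less_le zero_less_one mult_zero_left)
    finally show "0 < Im (l (u *\<^sub>R x + v *\<^sub>R y) i)" .
  qed
  then have "connected S"
    unfolding S_eq by (intro convex_connected convex_INT) auto
  have hol: "g a holomorphic_on S" for a
    unfolding g_def l_def by (intro holomorphic_intros)
  have 01: "0 \<in> S" "1 \<in> S"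
    using z by (auto simp: S_def l_def upper_points_def)
  have ev: "sparse_eval j I \<kappa>' e (l w) = (\<Sum>a\<in>I. \<kappa>' a * g a w)" for \<kappa>' w
    by (simp add: sparse_eval_def g_def)
  have l01: "l 0 = z" "l 1 = (\<lambda>_. \<i>)" by (auto simp: l_def)
  have "(\<lambda>w. sparse_eval j I k e (l w)) 0 \<noteq> 0"
  proof (rule Hurwitz_no_zeros[where S = S and g = "\<lambda>w. sparse_eval j I k e (l w)" and ?z0.0 = 0 and \<F> = "\<lambda>n w. sparse_eval j I (\<kappa> n) e (l w)"])
    show "uniform_limit K (\<lambda>n w. sparse_eval j I (\<kappa> n) e (l w)) (\<lambda>w. sparse_eval j I k e (l w)) sequentially"
      if "compact K" "K \<subseteq> S" for K
      unfolding ev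
    proof (rule uniform_limit_sum_scaled)
      show "bounded (g a ` K)" for a
        using hol[of a] that by (meson compact_continuous_image compact_imp_bounded
            continuous_on_subset holomorphic_on_imp_continuous_on)
    qed (use assms in auto)
    \<comment> \<open>The function is 0 at \<open>w = 0\<close> by assumption and nonzero at
      \<open>w = 1\<close> by \<open>ne\<close>.\<close>
    show "\<not> (\<lambda>w. sparse_eval j I k e (l w)) constant_on S"
      using 01 z0 ne l01 unfolding constant_on_def by metis
    show "sparse_eval j I (\<kappa> n) e (l w) \<noteq> 0" if "w \<in> S" for n w
      using nz that by (simp add: S_def)
  qed (use \<open>open S\<close> \<open>connected S\<close> 01 hol in \<open>auto simp: ev intro!: holomorphic_intros\<close>)
  then show False using z0 l01 by simp
qed

text \<open>At (i, ..., i) all surviving monomials take the same value i^(h-d) by homogeneity, so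
  positive coefficients cannot cancel. This supplies the hypothesis \<open>ne\<close> of the Hurwitz
  argument.\<close>

lemma sparse_eval_i:
  assumes "finite I"
    and "\<And>a. a \<in> I \<Longrightarrow> (\<Sum>i=1..Suc j. e a i) = h"
    and "\<And>a. a \<in> I \<Longrightarrow> k a = (if e a (Suc j) = d then v * complex_of_real (c a) else 0)"
    and "\<And>a. a \<in> I \<Longrightarrow> c a > 0" and "v \<noteq> 0" and "\<exists>a\<in>I. e a (Suc j) = d"
  shows "sparse_eval j I k e (\<lambda>_. \<i>) \<noteq> 0"
proof -
  have "k a * (\<Prod>i=1..j. \<i> ^ e a i) = 
    v * \<i> ^ (h - d) * complex_of_real (if e a (Suc j) = d then c a else 0)" if "a \<in> I" for a
  proof (cases "e a (Suc j) = d")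
    case True
    then have "(\<Sum>i=1..j. e a i) = h - d" using assms(2)[OF that] by auto
    then show ?thesis using assms(3)[OF that] True
      by (simp add: power_sum[symmetric])
  qed (use assms(3)[OF that] in auto)
  then have "sparse_eval j I k e (\<lambda>_. \<i>) =
     v * \<i> ^ (h - d) * complex_of_real (\<Sum>a\<in>I. if e a (Suc j) = d then c a else 0)"
    by (simp add: sparse_eval_def sum_distrib_left)
  moreover obtain b where "b \<in> I" "e b (Suc j) = d" using assms by blast
  then have "(\<Sum>a\<in>I. if e a (Suc j) = d then c a else 0) > 0"
    using assms by (intro sum_pos2[of _ b]) (auto simp: less_imp_le)
  ultimately show ?thesis using \<open>v \<noteq> 0\<close> by (simp del: of_real_sum)
qed

text \<open>Substituting i/\<epsilon> for the last variable and multiplying by \<epsilon>^d gives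
  nonvanishing polynomials whose limit is i^d times the leading coefficient. Hence the degree in the
  last variable is the same for every \<open>z\<close> in the upper half plane.\<close>

lemma sparse_eval_leading_nonzero:
  assumes "finite I" and c: "\<And>a. a \<in> I \<Longrightarrow> c a > 0"
    and hom: "\<And>a. a \<in> I \<Longrightarrow> (\<Sum>i=1..Suc j. e a i) = h"
    and stable: "\<And>z. z \<in> upper_points (Suc j) \<Longrightarrow> sparse_eval (Suc j) I (\<lambda>a. complex_of_real (c a)) e z \<noteq> 0"
    and d: "\<exists>a\<in>I. e a (Suc j) = d" "\<And>a. a \<in> I \<Longrightarrow> e a (Suc j) \<le> d"
    and z: "z \<in> upper_points j"
  shows "coeff (slice j I (\<lambda>a. complex_of_real (c a)) e z) d \<noteq> 0"
proof -
  define \<epsilon> where "\<epsilon> = (\<lambda>n. inverse (real (Suc n)))"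
  define \<kappa> where "\<kappa> = (\<lambda>n a. complex_of_real (c a) * \<i> ^ e a (Suc j) * complex_of_real (\<epsilon> n) ^ (d - e a (Suc j)))"
  define k where "k = (\<lambda>a. if e a (Suc j) = d then \<i> ^ d * complex_of_real (c a) else 0)"
  have \<epsilon>: "\<epsilon> n > 0" for n by (simp add: \<epsilon>_def)
  have e0: "(\<lambda>n. complex_of_real (\<epsilon> n)) \<longlonglongrightarrow> 0"
    unfolding \<epsilon>_def using LIMSEQ_inverse_real_of_nat by (metis of_real_0 tendsto_of_real)
  have "sparse_eval j I k e z \<noteq> 0"
  proof (rule sparse_eval_limit_nonzero[where \<kappa> = \<kappa>])
    fix n z assume z: "z \<in> upper_points j"
    define z' where "z' = z(Suc j := \<i> / complex_of_real (\<epsilon> n))"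
    have z': "z' \<in> upper_points (Suc j)"
      using z \<epsilon>[of n] by (auto simp: z'_def upper_points_def le_Suc_eq Im_divide_of_real)
    have "\<kappa> n a * (\<Prod>i=1..j. z i ^ e a i) =
      complex_of_real (\<epsilon> n) ^ d * (complex_of_real (c a) * (\<Prod>i=1..Suc j. z' i ^ e a i))" if "a \<in> I" for a
    proof -
      have "(\<Prod>i=1..j. z' i ^ e a i) = (\<Prod>i=1..j. z i ^ e a i)"
        by (intro prod.cong) (auto simp: z'_def)
      moreover have "complex_of_real (\<epsilon> n) ^ (d - e a (Suc j)) = complex_of_real (\<epsilon> n) ^ d / complex_of_real (\<epsilon> n) ^ e a (Suc j)"
        using d(2)[OF that] \<epsilon>[of n] by (intro power_diff) auto
      ultimately show ?thesis by (simp add: \<kappa>_def z'_def power_divide)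
    qed
    then have "sparse_eval j I (\<kappa> n) e z =
      complex_of_real (\<epsilon> n) ^ d * sparse_eval (Suc j) I (\<lambda>a. complex_of_real (c a)) e z'"
      by (simp add: sparse_eval_def sum_distrib_left)
    then show "sparse_eval j I (\<kappa> n) e z \<noteq> 0"
      using stable[OF z'] \<epsilon>[of n] by simp
  next
    fix a assume a: "a \<in> I"
    have "(\<lambda>n. \<kappa> n a) \<longlonglongrightarrow> complex_of_real (c a) * \<i> ^ e a (Suc j) * 0 ^ (d - e a (Suc j))"
      unfolding \<kappa>_def by (intro tendsto_intros e0)
    also have "complex_of_real (c a) * \<i> ^ e a (Suc j) * 0 ^ (d - e a (Suc j)) = k a"
      using d(2)[OF a] by (auto simp: k_def power_0_left)
    finally show "(\<lambda>n. \<kappa> n a) \<longlonglongrightarrow> k a" .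
  next
    show "sparse_eval j I k e (\<lambda>_. \<i>) \<noteq> 0"
      using assms by (intro sparse_eval_i[where h = h and v = "\<i> ^ d" and d = d and c = c]) (auto simp: k_def)
  qed (use assms in auto)
  moreover have "sparse_eval j I k e z = \<i> ^ d * coeff (slice j I (\<lambda>a. complex_of_real (c a)) e z) d"
    using \<open>finite I\<close> unfolding coeff_slice[OF \<open>finite I\<close>]
    by (auto simp: sparse_eval_def sum_distrib_left k_def sum.inter_filter intro!: sum.cong)
  ultimately show ?thesis by auto
qed

text \<open>Gauss--Lucas keeps the derivative in the last variable nonvanishing at \<open>\<i>\<epsilon>\<close>; then \<open>\<epsilon> \<rightarrow> 0\<close>.\<close>

lemma sparse_eval_deriv_stable:
  assumes "finite I" and c: "\<And>a. a \<in> I \<Longrightarrow> c a > 0"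
    and hom: "\<And>a. a \<in> I \<Longrightarrow> (\<Sum>i=1..Suc j. e a i) = h"
    and stable: "\<And>z. z \<in> upper_points (Suc j) \<Longrightarrow> sparse_eval (Suc j) I (\<lambda>a. complex_of_real (c a)) e z \<noteq> 0"
    and J: "\<exists>a\<in>I. e a (Suc j) = 1"
    and z: "z \<in> upper_points j"
  shows "sparse_eval j {a\<in>I. e a (Suc j) = 1} (\<lambda>a. complex_of_real (c a)) e z \<noteq> 0"
proof -
  define d where "d = Max ((\<lambda>a. e a (Suc j)) ` I)"
  have fin: "finite ((\<lambda>a. e a (Suc j)) ` I)" "(\<lambda>a. e a (Suc j)) ` I \<noteq> {}" using assms by auto
  have d: "\<exists>a\<in>I. e a (Suc j) = d" "\<And>a. a \<in> I \<Longrightarrow> e a (Suc j) \<le> d"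
    using Max_in[OF fin] Max_ge[OF fin(1)] unfolding d_def by auto
  have "d > 0" using J d(2) by force
  define \<epsilon> where "\<epsilon> = (\<lambda>n. inverse (real (Suc n)))"
  \<comment> \<open>These are the coefficients of the derivative in the last variable, taken at
    i\<epsilon>.\<close>
  define \<kappa> where "\<kappa> = (\<lambda>n a. of_nat (e a (Suc j)) * complex_of_real (c a) * (\<i> * complex_of_real (\<epsilon> n)) ^ (e a (Suc j) - 1))"
  define k where "k = (\<lambda>a. if e a (Suc j) = 1 then 1 * complex_of_real (c a) else 0)"
  have \<epsilon>: "\<epsilon> n > 0" for n by (simp add: \<epsilon>_def)
  have e0: "(\<lambda>n. complex_of_real (\<epsilon> n)) \<longlonglongrightarrow> 0"
    unfolding \<epsilon>_def using LIMSEQ_inverse_real_of_nat by (metis of_real_0 tendsto_of_real)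
  have "sparse_eval j I k e z \<noteq> 0"
  proof (rule sparse_eval_limit_nonzero[where \<kappa> = \<kappa>])
    fix n z assume z: "z \<in> upper_points j"
    let ?R = "slice j I (\<lambda>a. complex_of_real (c a)) e z"
    \<comment> \<open>Gauss--Lucas needs a nonconstant \<open>?R\<close> for each
      \<open>z\<close>.\<close>
    have "coeff ?R d \<noteq> 0"
      using assms d z by (intro sparse_eval_leading_nonzero) auto
    then have "degree ?R > 0" using \<open>d > 0\<close> le_degree[of ?R d] by linarith
    then have "poly (pderiv ?R) (\<i> * complex_of_real (\<epsilon> n)) \<noteq> 0"
    proof (rule pderiv_nonzero_upper_halfplane)
      show "poly ?R w \<noteq> 0" if "Im w > 0" for w
        unfolding poly_slice using z that by (intro stable) (auto simp: upper_points_def le_Suc_eq)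
    qed (use \<epsilon> in auto)
    also have "poly (pderiv ?R) (\<i> * complex_of_real (\<epsilon> n)) = sparse_eval j I (\<kappa> n) e z"
      by (simp add: slice_def sparse_eval_def \<kappa>_def pderiv_sum pderiv_monom poly_sum poly_monom mult_ac)
    finally show "sparse_eval j I (\<kappa> n) e z \<noteq> 0" .
  next
    fix a assume a: "a \<in> I"
    have "(\<lambda>n. \<kappa> n a) \<longlonglongrightarrow> of_nat (e a (Suc j)) * complex_of_real (c a) * (\<i> * 0) ^ (e a (Suc j) - 1)"
      unfolding \<kappa>_def by (intro tendsto_intros e0)
    also have "of_nat (e a (Suc j)) * complex_of_real (c a) * (\<i> * 0) ^ (e a (Suc j) - 1) = k a"
      \<comment> \<open>Exponents above 1 vanish through the power of 0. For exponent 0 the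
        truncated \<open>0 - 1\<close> makes that power 1, and the factor \<open>of_nat\<close>
        vanishes instead.\<close>
      by (cases "e a (Suc j)") (auto simp: k_def power_0_left)
    finally show "(\<lambda>n. \<kappa> n a) \<longlonglongrightarrow> k a" .
  next
    show "sparse_eval j I k e (\<lambda>_. \<i>) \<noteq> 0"
      using assms by (intro sparse_eval_i[where h = h and v = 1 and d = 1 and c = c]) (auto simp: k_def)
  qed (use assms in auto)
  moreover have "sparse_eval j I k e z = sparse_eval j {a\<in>I. e a (Suc j) = 1} (\<lambda>a. complex_of_real (c a)) e z"
    using \<open>finite I\<close> by (auto simp: sparse_eval_def k_def sum.inter_filter intro!: sum.cong)
  ultimately show ?thesis by auto
qed

text \<open>A nonreal root \<open>t\<close> over positive \<open>y\<close> would, after multiplying all variables by a suitable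
  \<open>u\<close>, move into the upper half plane together with \<open>y\<close>.\<close>

lemma slice_real_rooted:
  assumes "finite I" and c: "\<And>a. a \<in> I \<Longrightarrow> c a > 0"
    and hom: "\<And>a. a \<in> I \<Longrightarrow> (\<Sum>i=1..Suc j. e a i) = h"
    and stable: "\<And>z. z \<in> upper_points (Suc j) \<Longrightarrow> sparse_eval (Suc j) I (\<lambda>a. complex_of_real (c a)) e z \<noteq> 0"
    and y: "\<And>i. i \<in> {1..j} \<Longrightarrow> y i > 0"
    and nz: "poly (slice j I c e y) 0 \<noteq> 0"
    and w: "poly (map_poly complex_of_real (slice j I c e y)) w = 0"
  shows "w \<in> \<real> \<and> Re w < 0"
proof -
  have "Im w = 0"
  proof (rule ccontr)
    assume Im: "Im w \<noteq> 0"
    \<comment> \<open>Since Im (u w) = M Im w + Re w, this choice makes it positive for either sign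
      of \<open>Im w\<close>, while \<open>Im u = 1\<close> lifts the positive
      \<open>y i\<close>.\<close>
    define M where "M = (\<bar>Re w\<bar> + 1) / Im w"
    define u where "u = Complex M 1"
    have "Im (u * w) = \<bar>Re w\<bar> + 1 + Re w"
      using Im by (simp add: u_def M_def)
    then have uw: "Im (u * w) > 0" by linarith
    define x where "x = (\<lambda>i. complex_of_real (y i))(Suc j := w)"
    have "(\<lambda>i. u * x i) \<in> upper_points (Suc j)"
      using uw y by (auto simp: upper_points_def x_def le_Suc_eq u_def)
    then have "sparse_eval (Suc j) I (\<lambda>a. complex_of_real (c a)) e (\<lambda>i. u * x i) \<noteq> 0"
      by (rule stable)
    moreover have "sparse_eval (Suc j) I (\<lambda>a. complex_of_real (c a)) e x = 0"
      using w assms(1) by (simp add: map_poly_slice poly_slice x_def)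
    ultimately show False using hom by (simp add: sparse_eval_scale)
  qed
  then obtain r where r: "w = complex_of_real r"
    by (metis complex_is_Real_iff Reals_cases)
  have coeff: "coeff (slice j I c e y) k \<ge> 0" for k
    unfolding coeff_slice[OF \<open>finite I\<close>] using c y by (intro sparse_eval_nonneg) auto
  \<comment> \<open>Nonnegative coefficients with a positive constant term exclude
    \<open>r \<ge> 0\<close>.\<close>
  have "r < 0"
  proof (rule ccontr)
    assume "\<not> r < 0"
    then have "poly (slice j I c e y) r \<ge> (\<Sum>k\<in>{0}. coeff (slice j I c e y) k * r ^ k)"
      unfolding poly_altdef using coeff by (intro sum_mono2) auto
    then have "poly (slice j I c e y) r > 0"
      using nz coeff[of 0] by (simp add: poly_0_coeff_0)
    then show False using w r by (simp add: poly_of_real_poly)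
  qed
  then show ?thesis using r by simp
qed

section \<open>Gurvits' capacity inequality\<close>

text \<open>The coefficient of the last variable satisfies the hypotheses again, with one variable
  and one degree less and with \<open>g * C\<close> for \<open>C\<close>. The factors
  \<open>g\<close> telescope to j!/j^j.\<close>

theorem capacity_inequality:
  assumes "finite I" and "\<And>a. a \<in> I \<Longrightarrow> c a > 0"
    and "\<And>a. a \<in> I \<Longrightarrow> (\<Sum>i=1..j. e a i) = j"
    and "\<And>z. z \<in> upper_points j \<Longrightarrow> sparse_eval j I (\<lambda>a. complex_of_real (c a)) e z \<noteq> 0"
    and "C \<ge> 0"
    and "\<And>y. (\<And>i. i \<in> {1..j} \<Longrightarrow> y i > 0) \<Longrightarrow> sparse_eval j I c e y \<ge> C * (\<Prod>i=1..j. y i)"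
  shows "(\<Sum>a | a \<in> I \<and> (\<forall>i\<in>{1..j}. e a i = 1). c a) \<ge> fact j / real j ^ j * C"
  using assms
proof (induction j arbitrary: I C)
  case 0
  then show ?case by (simp add: sparse_eval_def)
next
  case (Suc j)
  define J where "J = {a\<in>I. e a (Suc j) = 1}"
  define g where "g = (real j / real (Suc j)) ^ j"
  have g: "g > 0" by (cases j) (auto simp: g_def)
  have bound: "sparse_eval j J c e y \<ge> g * C * (\<Prod>i=1..j. y i)" if y: "\<And>i. i \<in> {1..j} \<Longrightarrow> y i > 0" for y
  proof -
    let ?R = "slice j I c e y"
    have "coeff ?R 1 \<ge> (real j / real (Suc j)) ^ j * (C * (\<Prod>i=1..j. y i))"
    proof (rule coeff_1_ge_capacity)
      show "w \<in> \<real> \<and> Re w < 0" if "poly ?R 0 \<noteq> 0" "poly (map_poly complex_of_real ?R) w = 0" for w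
        using slice_real_rooted[of I c e j "Suc j" y w] Suc.prems y that by blast
      show "0 \<le> poly ?R 0"
        unfolding poly_0_coeff_0 coeff_slice[OF Suc.prems(1)]
        using Suc.prems(2) y by (intro sparse_eval_nonneg) auto
      show "degree ?R \<le> Suc j"
      proof (rule degree_le, intro allI impI)
        fix k assume k: "Suc j < k"
        have "e a (Suc j) \<noteq> k" if "a \<in> I" for a
          using Suc.prems(3)[OF that] k by auto
        then have "{a\<in>I. e a (Suc j) = k} = {}" by auto
        then show "coeff ?R k = 0"
          unfolding coeff_slice[OF Suc.prems(1)] by (simp only: sparse_eval_def sum.empty)
      qed
      show "0 \<le> C * (\<Prod>i=1..j. y i)"
        using Suc.prems y by (intro mult_nonneg_nonneg prod_nonneg) (auto simp: less_imp_le)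
      show "C * (\<Prod>i=1..j. y i) * t \<le> poly ?R t" if "t > 0" for t
      proof -
        have "C * (\<Prod>i=1..Suc j. (y(Suc j := t)) i) \<le> sparse_eval (Suc j) I c e (y(Suc j := t))"
          using y that by (intro Suc.prems(6)) (auto simp: le_Suc_eq)
        moreover have "(\<Prod>i=1..j. (y(Suc j := t)) i) = (\<Prod>i=1..j. y i)"
          by (intro prod.cong) auto
        ultimately show ?thesis
          unfolding poly_slice by (simp add: mult_ac)
      qed
    qed
    then show ?thesis using Suc.prems(1) by (simp add: coeff_slice J_def g_def mult_ac)
  qed
  have fact_eq: "fact (Suc j) / real (Suc j) ^ Suc j * C = fact j / real j ^ j * (g * C)"
  proof (cases "j = 0")
    case False
    have "fact (Suc j) / real (Suc j) ^ Suc j = fact j / real (Suc j) ^ j"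
      by (simp del: of_nat_Suc)
    also have "\<dots> = fact j / real j ^ j * g"
      using False by (simp add: g_def power_divide)
    finally show ?thesis by simp
  qed (simp add: g_def)
  show ?case
  proof (cases "J = {}")
    \<comment> \<open>The zero polynomial is not stable, so the induction hypothesis is out of
      reach; the bound at (1, ..., 1) then forces \<open>C = 0\<close>.\<close>
    case True
    then have "C \<le> 0" using bound[of "\<lambda>_. 1"] g by (simp add: sparse_eval_def mult_le_0_iff)
    then have "C = 0" using Suc.prems by simp
    moreover have "(\<Sum>a | a \<in> I \<and> (\<forall>i\<in>{1..Suc j}. e a i = 1). c a) \<ge> 0"
      using Suc.prems(2) by (intro sum_nonneg) (auto simp: less_imp_le)
    ultimately show ?thesis by simp
  next
    case False
    have "fact j / real j ^ j * (g * C) \<le> (\<Sum>a | a \<in> J \<and> (\<forall>i\<in>{1..j}. e a i = 1). c a)"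
    proof (rule Suc.IH)
      show "(\<Sum>i=1..j. e a i) = j" if "a \<in> J" for a
        using Suc.prems(3)[of a] that by (simp add: J_def)
      show "sparse_eval j J (\<lambda>a. complex_of_real (c a)) e z \<noteq> 0" if "z \<in> upper_points j" for z
        unfolding J_def
        using Suc.prems False that
        by (intro sparse_eval_deriv_stable[where h = "Suc j"]) (auto simp: J_def)
    qed (use Suc.prems g bound in \<open>auto simp: J_def\<close>)
    also have "{a. a \<in> J \<and> (\<forall>i\<in>{1..j}. e a i = 1)} = {a. a \<in> I \<and> (\<forall>i\<in>{1..Suc j}. e a i = 1)}"
      by (auto simp: J_def le_Suc_eq)
    finally show ?thesis unfolding fact_eq .
  qed
qed

section \<open>Sums of multilinear coefficients\<close>

text \<open>Each list records the summand chosen from each factor. Words in place of multinomial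
  coefficients suit the repeated exponent vectors that \<open>sparse_eval\<close> admits.\<close>

lemma sum_power_eq_sum_lists:
  fixes x :: "'a \<Rightarrow> 'b::comm_semiring_1"
  assumes "finite A"
  shows "(\<Sum>i\<in>A. x i) ^ k = (\<Sum>xs | set xs \<subseteq> A \<and> length xs = k. prod_list (map x xs))"
proof (induction k)
  case 0
  have "{xs. set xs \<subseteq> A \<and> length xs = 0} = {[]}" by auto
  then show ?case by simp
next
  case (Suc k)
  let ?L = "{xs. set xs \<subseteq> A \<and> length xs = k}"
  have "{xs. set xs \<subseteq> A \<and> length xs = Suc k} = (\<lambda>(i, xs). i # xs) ` (A \<times> ?L)"
    by (auto simp: length_Suc_conv image_iff)
  moreover have "inj_on (\<lambda>(i, xs). i # xs) (A \<times> ?L)" by (auto simp: inj_on_def)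
  ultimately have "(\<Sum>xs | set xs \<subseteq> A \<and> length xs = Suc k. prod_list (map x xs))
      = (\<Sum>(i, xs)\<in>A \<times> ?L. x i * prod_list (map x xs))"
    by (simp add: sum.reindex case_prod_unfold)
  also have "\<dots> = (\<Sum>i\<in>A. x i) * (\<Sum>xs\<in>?L. prod_list (map x xs))"
    by (simp add: sum_product sum.cartesian_product)
  finally show ?case by (simp add: Suc.IH)
qed

lemma prod_power_count_list:
  fixes x :: "'a \<Rightarrow> 'b::comm_semiring_1"
  assumes "finite A" "set xs \<subseteq> A"
  shows "(\<Prod>i\<in>A. x i ^ count_list xs i) = prod_list (map x xs)"
  using assms(2)
proof (induction xs)
  case (Cons y ys)
  have "(\<Prod>i\<in>A. x i ^ count_list (y # ys) i) =
      (\<Prod>i\<in>A. (if i = y then x i else 1) * x i ^ count_list ys i)"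
    by (intro prod.cong) auto
  also have "\<dots> = x y * prod_list (map x ys)"
    using Cons assms(1) by (simp add: prod.distrib prod.delta)
  finally show ?case by simp
qed simp

lemma count_list_distinct: "distinct xs \<Longrightarrow> count_list xs i = (if i \<in> set xs then 1 else 0)"
  by (induction xs) auto

text \<open>Choosing a term of the first factor and a word adds their exponents. No terms are
  merged, so positivity of the coefficients carries over to the product.\<close>

lemma sparse_eval_mult_sum_power:
  fixes f :: "'a \<Rightarrow> 'b::comm_semiring_1"
  shows "sparse_eval m (K \<times> {xs. set xs \<subseteq> {1..m} \<and> length xs = k}) (\<lambda>(t, xs). f t)
      (\<lambda>(t, xs) i. e t i + count_list xs i) x = sparse_eval m K f e x * (\<Sum>i=1..m. x i) ^ k"
proof -
  let ?L = "{xs. set xs \<subseteq> {1..m} \<and> length xs = k}"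
  have "sparse_eval m (K \<times> ?L) (\<lambda>(t, xs). f t) (\<lambda>(t, xs) i. e t i + count_list xs i) x =
    (\<Sum>(t, xs)\<in>K \<times> ?L. (f t * (\<Prod>i=1..m. x i ^ e t i)) * prod_list (map x xs))"
    unfolding sparse_eval_def
    by (intro sum.cong) (auto simp: power_add prod.distrib prod_power_count_list mult.assoc)
  also have "\<dots> = sparse_eval m K f e x * (\<Sum>i=1..m. x i) ^ k"
    by (simp add: sum_power_eq_sum_lists sparse_eval_def sum_product sum.cartesian_product)
  finally show ?thesis .
qed

section \<open>From \<open>mpoly\<close> to \<open>sparse_eval\<close>, and the multilinear
  coefficient\<close>

lemma mpoly_eval_eq_sparse_eval:
  assumes "p \<in> mpolys m"
  shows "mpoly_eval p x = sparse_eval m (Poly_Mapping.keys p) (Poly_Mapping.lookup p) Poly_Mapping.lookup x"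
  unfolding mpoly_eval_def sparse_eval_def
proof (intro sum.cong refl arg_cong2[where f = "(*)"] prod.mono_neutral_left ballI)
  fix t assume "t \<in> Poly_Mapping.keys p"
  then show "Poly_Mapping.keys t \<subseteq> {1..m}" using assms by (auto simp: mpolys_def)
qed (auto simp: in_keys_iff)

lemma lookup_map_of_real:
  "Poly_Mapping.lookup (Poly_Mapping.map complex_of_real p) t = complex_of_real (Poly_Mapping.lookup p t)"
  by (simp add: map.rep_eq when_def)

lemma keys_map_of_real: "Poly_Mapping.keys (Poly_Mapping.map complex_of_real p) = Poly_Mapping.keys p"
  by (auto simp: in_keys_iff lookup_map_of_real)

lemma sum_lookup_homogeneous:
  assumes "p \<in> mpolys m" "mpoly_homogeneous n p" "t \<in> Poly_Mapping.keys p"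
  shows "(\<Sum>i=1..m. Poly_Mapping.lookup t i) = n"
proof -
  have "monom_degree t = (\<Sum>i=1..m. Poly_Mapping.lookup t i)"
    unfolding monom_degree_def using assms(1,3)
    by (intro sum.mono_neutral_left) (auto simp: mpolys_def in_keys_iff)
  then show ?thesis using assms(2,3) by (simp add: mpoly_homogeneous_def)
qed

lemma lookup_sum_single:
  assumes "finite S"
  shows "Poly_Mapping.lookup (\<Sum>j\<in>S. Poly_Mapping.single j (1::nat)) i = (if i \<in> S then 1 else 0)"
  using assms by (simp add: lookup_sum lookup_single when_def)

text \<open>All exponents of a pair (t, xs) are 1 exactly when t is the monomial of an
  \<open>n\<close>-set S and xs lists its complement without repetition. Each S thus occurs with
  (m-n)! words.\<close>

lemma sum_multilinear_coefficients:
  fixes p :: "real mpoly"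
  assumes "n \<le> m" "p \<in> mpolys m" "mpoly_homogeneous n p"
  shows "(\<Sum>a | a \<in> Poly_Mapping.keys p \<times> {xs. set xs \<subseteq> {1..m} \<and> length xs = m - n} \<and>
        (\<forall>i\<in>{1..m}. (case a of (t, xs) \<Rightarrow> \<lambda>i. Poly_Mapping.lookup t i + count_list xs i) i = 1).
        case a of (t, xs) \<Rightarrow> Poly_Mapping.lookup p t)
      = fact (m - n) * (\<Sum>S\<in>n_subsets m n. set_coeff p S)" (is "sum _ ?X = _")
proof -
  define mono :: "nat set \<Rightarrow> nat \<Rightarrow>\<^sub>0 nat" where "mono S = (\<Sum>i\<in>S. Poly_Mapping.single i 1)" for S
  \<comment> \<open>Sets whose monomial is absent from \<open>p\<close> have coefficient 0 and
    return at the end of the calculation.\<close>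
  define N where "N = {S \<in> n_subsets m n. mono S \<in> Poly_Mapping.keys p}"
  have lookup_mono: "Poly_Mapping.lookup (mono S) i = (if i \<in> S then 1 else 0)" if "S \<subseteq> {1..m}" for S i
    using that finite_subset[OF that] unfolding mono_def by (intro lookup_sum_single) auto
  have fin: "finite (n_subsets m n)"
    by (rule finite_subset[of _ "Pow {1..m}"]) (auto simp: n_subsets_def)
  have X_eq: "?X = (\<lambda>(S, xs). (mono S, xs)) ` (SIGMA S:N. permutations_of_set ({1..m} - S))"
  proof (intro equalityI subsetI)
    fix a assume "a \<in> ?X"
    then obtain t xs where a: "a = (t, xs)" and t: "t \<in> Poly_Mapping.keys p"
      and xs: "set xs \<subseteq> {1..m}" "length xs = m - n"
      and one: "\<And>i. i \<in> {1..m} \<Longrightarrow> Poly_Mapping.lookup t i + count_list xs i = 1"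
      by auto
    define S where "S = Poly_Mapping.keys t"
    have S: "S \<subseteq> {1..m}" using t assms by (auto simp: S_def mpolys_def)
    have l1: "Poly_Mapping.lookup t i = 1" if "i \<in> S" for i
    proof -
      have "i \<in> {1..m}" "Poly_Mapping.lookup t i \<noteq> 0"
        using that S unfolding S_def in_keys_iff[symmetric] by blast+
      then show ?thesis using one[of i] by linarith
    qed
    have tS: "t = mono S"
    proof (rule poly_mapping_eqI)
      show "Poly_Mapping.lookup t i = Poly_Mapping.lookup (mono S) i" for i
        unfolding lookup_mono[OF S] using l1[of i] by (cases "i \<in> S") (simp_all add: S_def in_keys_iff)
    qed
    have "monom_degree t = card S"
      unfolding monom_degree_def S_def[symmetric] using l1 by simp
    then have card: "card S = n"
      using t assms by (auto simp: mpoly_homogeneous_def)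
    have "i \<in> set xs \<longleftrightarrow> i \<in> {1..m} - S" for i
    proof (cases "i \<in> {1..m}")
      case True
      then show ?thesis using one[OF True] count_list_0_iff[of xs i]
        by (auto simp: tS lookup_mono[OF S] split: if_splits)
    qed (use xs in auto)
    then have set: "set xs = {1..m} - S" by blast
    \<comment> \<open>Equality of these numbers means that \<open>xs\<close> has no
      repetition.\<close>
    then have "card (set xs) = length xs"
      using xs S card finite_subset[OF S] by (simp add: card_Diff_subset)
    then have "xs \<in> permutations_of_set ({1..m} - S)"
      using set by (auto simp: permutations_of_set_def intro: card_distinct)
    then show "a \<in> (\<lambda>(S, xs). (mono S, xs)) ` (SIGMA S:N. permutations_of_set ({1..m} - S))"
      using a tS S card t by (intro image_eqI[of _ _ "(S, xs)"]) (auto simp: N_def n_subsets_def)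
  next
    fix a assume "a \<in> (\<lambda>(S, xs). (mono S, xs)) ` (SIGMA S:N. permutations_of_set ({1..m} - S))"
    then obtain S xs where a: "a = (mono S, xs)" and S: "S \<in> N"
      and "xs \<in> permutations_of_set ({1..m} - S)"
      by auto
    then have set: "set xs = {1..m} - S" and dist: "distinct xs"
      by (auto simp: permutations_of_set_def)
    have S': "S \<subseteq> {1..m}" "card S = n" using S by (auto simp: N_def n_subsets_def)
    have "length xs = m - n"
      using distinct_card[OF dist] set S' finite_subset[OF S'(1)] by (simp add: card_Diff_subset)
    then show "a \<in> ?X"
      using a S set dist by (auto simp: N_def lookup_mono[OF S'(1)] count_list_distinct)
  qed
  have "inj_on (\<lambda>(S, xs). (mono S, xs)) (SIGMA S:N. permutations_of_set ({1..m} - S))"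
  proof (rule inj_onI, clarsimp)
    fix S T assume "S \<in> N" "T \<in> N" "mono S = mono T"
    then have "(if i \<in> S then 1 else 0 :: nat) = (if i \<in> T then 1 else 0)" for i
      by (metis (no_types, lifting) lookup_mono N_def n_subsets_def mem_Collect_eq)
    then show "S = T" by (metis (full_types) subsetI equalityI zero_neq_one)
  qed
  then have "(\<Sum>a\<in>?X. case a of (t, xs) \<Rightarrow> Poly_Mapping.lookup p t) =
      (\<Sum>(S, xs)\<in>(SIGMA S:N. permutations_of_set ({1..m} - S)). set_coeff p S)"
    unfolding X_eq by (subst sum.reindex) (auto simp: case_prod_unfold set_coeff_def mono_def)
  also have "\<dots> = (\<Sum>S\<in>N. \<Sum>xs\<in>permutations_of_set ({1..m} - S). set_coeff p S)"
    using fin by (subst sum.Sigma) (auto simp: N_def)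
  also have "\<dots> = (\<Sum>S\<in>N. fact (m - n) * set_coeff p S)"
  proof (intro sum.cong refl)
    fix S assume "S \<in> N"
    then have S': "S \<subseteq> {1..m}" "card S = n" by (auto simp: N_def n_subsets_def)
    then have "card ({1..m} - S) = m - n"
      using finite_subset[OF S'(1)] by (simp add: card_Diff_subset)
    then show "(\<Sum>xs\<in>permutations_of_set ({1..m} - S). set_coeff p S) = fact (m - n) * set_coeff p S"
      by simp
  qed
  also have "\<dots> = (\<Sum>S\<in>n_subsets m n. fact (m - n) * set_coeff p S)"
    using fin by (intro sum.mono_neutral_left) (auto simp: N_def set_coeff_def mono_def in_keys_iff)
  finally show ?thesis by (simp add: sum_distrib_left)
qed

section \<open>The constant e^(-n)\<close>

text \<open>For m > 0 the ratio of consecutive terms is e / (1 + 1/m)^m, which is at least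
  1.\<close>

lemma fact_exp_over_power_incseq: "incseq (\<lambda>m. fact m * exp (real m) / real m ^ m)"
proof (rule incseq_SucI)
  fix m
  show "fact m * exp (real m) / real m ^ m \<le> fact (Suc m) * exp (real (Suc m)) / real (Suc m) ^ Suc m"
  proof (cases "m = 0")
    case False
    have "(1 + 1 / real m) ^ m \<le> exp 1"
      using False by (intro exp_ge_one_plus_x_over_n_power_n) auto
    also have "1 + 1 / real m = real (Suc m) / real m"
      using False by (simp add: field_simps)
    finally have "1 / real m ^ m \<le> exp 1 / real (Suc m) ^ m"
      using False by (simp add: power_divide field_simps del: of_nat_Suc)
    then have "fact m * exp (real m) * (1 / real m ^ m) \<le> fact m * exp (real m) * (exp 1 / real (Suc m) ^ m)"
      by (intro mult_left_mono) auto
    also have "\<dots> = fact (Suc m) * exp (real (Suc m)) / real (Suc m) ^ Suc m"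
      by (simp add: exp_add exp_of_nat_mult[symmetric] del: of_nat_Suc) (simp add: exp_add)
    finally show ?thesis by simp
  qed simp
qed

text \<open>Rearranges the comparison of the terms of the increasing sequence at
  \<open>m - n\<close> and \<open>m\<close>; the case m = n uses 0^0 = 1.\<close>

lemma exp_minus_le_constant:
  assumes "n \<le> m"
  shows "exp (- real n) \<le> (fact m * real (m - n) ^ (m - n)) / (real m ^ m * fact (m - n))"
proof -
  define k where "k = m - n"
  have "fact k * exp (real k) / real k ^ k \<le> fact m * exp (real m) / real m ^ m"
    using fact_exp_over_power_incseq by (rule incseqD) (simp add: k_def)
  also have "exp (real m) = exp (real k) * exp (real n)"
    using assms by (simp add: k_def exp_add[symmetric])
  finally have "exp (real k) * (fact k / real k ^ k) \<le> exp (real k) * (fact m * exp (real n) / real m ^ m)"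
    by (simp add: mult_ac)
  then have 1: "fact k / real k ^ k \<le> fact m * exp (real n) / real m ^ m"
    by (simp only: mult_le_cancel_left_pos exp_gt_zero)
  have kk: "real k ^ k > 0" by (cases "k = 0") auto
  have "exp (- real n) * (real k ^ k / fact k) * (fact k / real k ^ k)
      \<le> exp (- real n) * (real k ^ k / fact k) * (fact m * exp (real n) / real m ^ m)"
    using kk by (intro mult_left_mono 1) auto
  also have "\<dots> = (exp (- real n) * exp (real n)) * ((fact m * real k ^ k) / (real m ^ m * fact k))"
    by (simp add: mult_ac)
  finally show ?thesis using kk by (simp add: k_def exp_minus)
qed

text \<open>Rescaling makes the smallest of the products \<open>y\<^sup>S\<close> equal to \<open>1\<close>, so that \<open>y\<close> becomes feasible;
  AM-GM on the complement of \<open>S\<close> bounds the remaining factor.\<close>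

lemma feasible_lower_bound_imp_capacity:
  fixes p :: "real mpoly"
  assumes "n \<le> m" "p \<in> mpolys m" "mpoly_homogeneous n p"
    and q: "\<And>y. y \<in> feasible_points m n \<Longrightarrow> q \<le> mpoly_eval p y" "q \<ge> 0"
    and y: "\<And>i. i \<in> {1..m} \<Longrightarrow> y i > 0"
  shows "q * real (m - n) ^ (m - n) * (\<Prod>i=1..m. y i) \<le> mpoly_eval p y * (\<Sum>i=1..m. y i) ^ (m - n)"
proof -
  have fin: "finite (n_subsets m n)"
    by (rule finite_subset[of _ "Pow {1..m}"]) (auto simp: n_subsets_def)
  \<comment> \<open>Since \<open>n \<le> m\<close> the finite family is nonempty, so a minimal
    product exists.\<close>
  have "{1..n} \<in> n_subsets m n" using assms by (auto simp: n_subsets_def)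
  then obtain S where S: "S \<in> n_subsets m n" and
    min: "\<And>T. T \<in> n_subsets m n \<Longrightarrow> (\<Prod>i\<in>S. y i) \<le> (\<Prod>i\<in>T. y i)"
    using fin ex_min_if_finite[of "(\<lambda>S. \<Prod>i\<in>S. y i) ` n_subsets m n"]
    by (metis (no_types, lifting) empty_iff finite_imageI image_iff linorder_not_less)
  define \<pi> where "\<pi> = (\<Prod>i\<in>S. y i)"
  have S': "S \<subseteq> {1..m}" "card S = n" "finite S"
    using S finite_subset by (auto simp: n_subsets_def)
  have \<pi>: "\<pi> > 0" unfolding \<pi>_def using S' y by (intro prod_pos) auto
  \<comment> \<open>For \<open>n = 0\<close> the product \<open>\<pi>\<close> is empty and
    \<open>u = 1\<close> serves; otherwise \<open>u\<close> is an \<open>n\<close>-th root.\<close>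
  obtain u where u: "u > 0" "u ^ n = 1 / \<pi>"
  proof (cases "n = 0")
    case True
    then show ?thesis using that[of 1] S' by (auto simp: \<pi>_def)
  next
    case False
    then show ?thesis using that[of "root n (1 / \<pi>)"] \<pi> by (auto simp: real_root_pow_pos2)
  qed
  have "(\<lambda>i. u * y i) \<in> feasible_points m n"
  proof -
    have "(\<Prod>i\<in>T. u * y i) \<ge> 1" if "T \<in> n_subsets m n" for T
      using min[OF that] that \<pi> u by (simp add: prod.distrib n_subsets_def \<pi>_def)
    then show ?thesis using u y by (auto simp: feasible_points_def)
  qed
  then have "q \<le> mpoly_eval p (\<lambda>i. u * y i)" by (rule q(1))
  also have "\<dots> = u ^ n * mpoly_eval p y"
    unfolding mpoly_eval_eq_sparse_eval[OF assms(2)]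
    by (intro sparse_eval_scale sum_lookup_homogeneous[OF assms(2,3)])
  finally have 1: "q * \<pi> \<le> mpoly_eval p y" using u \<pi> by (simp add: pos_le_divide_eq)
  define T where "T = {1..m} - S"
  have cT: "card T = m - n" using S' by (simp add: T_def card_Diff_subset)
  have "real (m - n) ^ (m - n) * prod y T \<le> sum y T ^ (m - n)"
    using prod_le_power_mean[of T y] y cT by (simp add: T_def)
  also have "\<dots> \<le> (\<Sum>i=1..m. y i) ^ (m - n)"
    using y by (intro power_mono sum_mono2 sum_nonneg) (auto simp: T_def less_imp_le)
  finally have 2: "real (m - n) ^ (m - n) * prod y T \<le> (\<Sum>i=1..m. y i) ^ (m - n)" .
  have "q * real (m - n) ^ (m - n) * (\<Prod>i=1..m. y i) = (q * \<pi>) * (real (m - n) ^ (m - n) * prod y T)"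
    using prod.subset_diff[of S "{1..m}" y] S' by (simp add: \<pi>_def T_def mult_ac)
  also have "\<dots> \<le> mpoly_eval p y * (\<Sum>i=1..m. y i) ^ (m - n)"
  proof (intro mult_mono 1 2)
    show "0 \<le> mpoly_eval p y" using 1 q \<pi> by (meson mult_nonneg_nonneg less_imp_le order_trans)
    show "0 \<le> real (m - n) ^ (m - n) * prod y T"
      using y by (intro mult_nonneg_nonneg prod_nonneg) (auto simp: T_def less_imp_le)
  qed
  finally show ?thesis .
qed

theorem theorem1p2:
  fixes m n :: nat and p :: "real mpoly"
  assumes "n \<le> m"
    and "p \<in> mpolys m"
    and "mpoly_homogeneous n p"
    and "mpoly_real_stable m p"
    and "\<And>t. Poly_Mapping.lookup p t \<ge> 0"
    and "(\<Sum>S \<in> n_subsets m n. set_coeff p S) > 0"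
  shows "(\<Sum>S \<in> n_subsets m n. set_coeff p S)
           \<ge> (fact m * real (m - n) ^ (m - n)) / (real m ^ m * fact (m - n))
               * (INF y \<in> feasible_points m n. mpoly_eval p y)
       \<and> (fact m * real (m - n) ^ (m - n)) / (real m ^ m * fact (m - n))
               * (INF y \<in> feasible_points m n. mpoly_eval p y)
           \<ge> exp (- real n) * (INF y \<in> feasible_points m n. mpoly_eval p y)"
proof -
  define q where "q = (INF y \<in> feasible_points m n. mpoly_eval p y)"
  define k where "k = m - n"
  define L where "L = {xs. set xs \<subseteq> {1..m} \<and> length xs = k}"
  define c where "c = (\<lambda>(t, xs :: nat list). Poly_Mapping.lookup p t)"
  define e where "e = (\<lambda>(t, xs) (i :: nat). Poly_Mapping.lookup t i + count_list xs i :: nat)"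
  have c_pos: "Poly_Mapping.lookup p t > 0" if "t \<in> Poly_Mapping.keys p" for t
    using assms(5)[of t] that by (simp add: in_keys_iff less_le)
  have nonneg: "mpoly_eval p y \<ge> 0" if "y \<in> feasible_points m n" for y
    unfolding mpoly_eval_eq_sparse_eval[OF assms(2)]
    using c_pos that by (intro sparse_eval_nonneg) (auto simp: feasible_points_def)
  \<comment> \<open>A nonempty feasible set and values bounded below by 0 make the real-valued
    \<open>INF\<close> a genuine infimum.\<close>
  have "(\<lambda>_. 1) \<in> feasible_points m n" by (simp add: feasible_points_def)
  then have q0: "q \<ge> 0" unfolding q_def using nonneg by (intro cINF_greatest) auto
  have q_le: "q \<le> mpoly_eval p y" if "y \<in> feasible_points m n" for y
    unfolding q_def using nonneg that by (intro cINF_lower bdd_belowI[of _ 0]) auto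
  \<comment> \<open>The capacity inequality for p(y) (y_1 + ... + y_m)^k, indexed by pairs of a
    monomial and a word, with \<open>C = q * real k ^ k\<close>.\<close>
  have "fact m / real m ^ m * (q * real k ^ k) \<le>
    (\<Sum>a | a \<in> Poly_Mapping.keys p \<times> L \<and> (\<forall>i\<in>{1..m}. e a i = 1). c a)"
  proof (rule capacity_inequality)
    show "finite (Poly_Mapping.keys p \<times> L)"
      by (simp add: L_def finite_lists_length_eq)
    show "c a > 0" if "a \<in> Poly_Mapping.keys p \<times> L" for a
      using that c_pos by (auto simp: c_def)
    show "(\<Sum>i=1..m. e a i) = m" if "a \<in> Poly_Mapping.keys p \<times> L" for a
    proof -
      obtain t xs where a: "a = (t, xs)" by force
      have "(\<Sum>i=1..m. Poly_Mapping.lookup t i) = n"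
        using that a by (intro sum_lookup_homogeneous[OF assms(2,3)]) auto
      moreover have "(\<Sum>i=1..m. count_list xs i) = k"
        using that a by (simp add: L_def sum_count_set)
      ultimately show ?thesis using assms(1) by (simp add: a e_def sum.distrib k_def)
    qed
    show "sparse_eval m (Poly_Mapping.keys p \<times> L) (\<lambda>a. complex_of_real (c a)) e z \<noteq> 0"
      if z: "z \<in> upper_points m" for z
    proof -
      have pc: "Poly_Mapping.map complex_of_real p \<in> mpolys m"
        using assms(2) by (simp add: mpolys_def keys_map_of_real)
      have "mpoly_eval (Poly_Mapping.map complex_of_real p) z \<noteq> 0"
        using assms(4) z by (simp add: mpoly_real_stable_def mpoly_stable_def upper_points_def)
      moreover have "(\<Sum>i=1..m. z i) ^ k \<noteq> 0"
      \<comment> \<open>A nonempty sum of points of the upper half plane stays there; for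
        \<open>m = 0\<close> the sum is 0, but \<open>k = 0\<close> turns its power into 1.\<close>
      proof (cases "m = 0")
        case False
        then have "Im (\<Sum>i=1..m. z i) > 0"
          unfolding Im_sum using z by (intro sum_pos) (auto simp: upper_points_def)
        then have "(\<Sum>i=1..m. z i) \<noteq> 0" by (metis less_irrefl zero_complex.sel(2))
        then show ?thesis by simp
      qed (simp add: k_def)
      moreover have "(\<lambda>a. complex_of_real (c a)) = (\<lambda>(t, xs). complex_of_real (Poly_Mapping.lookup p t))"
        by (auto simp: c_def)
      ultimately show ?thesis
        unfolding mpoly_eval_eq_sparse_eval[OF pc] keys_map_of_real lookup_map_of_real[abs_def] L_def e_def
        by (simp only: sparse_eval_mult_sum_power) simp
    qed
    show "0 \<le> q * real k ^ k" using q0 by simp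
    show "q * real k ^ k * (\<Prod>i=1..m. y i) \<le> sparse_eval m (Poly_Mapping.keys p \<times> L) c e y"
      if "\<And>i. i \<in> {1..m} \<Longrightarrow> y i > 0" for y
      using feasible_lower_bound_imp_capacity[OF assms(1-3) q_le q0 that]
      unfolding c_def L_def e_def sparse_eval_mult_sum_power
      by (simp add: k_def mpoly_eval_eq_sparse_eval[OF assms(2)])
  qed
  also have "\<dots> = fact k * (\<Sum>S\<in>n_subsets m n. set_coeff p S)"
    using sum_multilinear_coefficients[OF assms(1-3)] unfolding c_def L_def e_def k_def .
  finally have "fact m / real m ^ m * (q * real k ^ k) / fact k \<le> (\<Sum>S\<in>n_subsets m n. set_coeff p S)"
    by (subst pos_divide_le_eq) (simp_all only: fact_gt_zero mult.commute)
  then have "(fact m * real k ^ k) / (real m ^ m * fact k) * q \<le> (\<Sum>S\<in>n_subsets m n. set_coeff p S)"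
    by (simp add: mult_ac)
  moreover have "exp (- real n) * q \<le> (fact m * real k ^ k) / (real m ^ m * fact k) * q"
    unfolding k_def by (intro mult_right_mono exp_minus_le_constant assms(1) q0)
  ultimately show ?thesis unfolding q_def k_def by blast
qed

end
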